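(* For $r=1,2$ let $\mathcal{F}_{n_r}^{\alpha_r,\beta_r}=\{\varphi_{n_r,i_r}(u_r):u_r\in[\alpha_r,\beta_r]\}_{i_r=0}^{n_r}$, $\varphi_{n_r,0}\equiv1$, be ordinary EC bases of vector spaces $\mathbb{S}_{n_r}^{\alpha_r,\beta_r}$ of functions, and let $\mathcal{B}_{n_r}^{\alpha_r,\beta_r}=\{b_{n_r,j_r}(u_r):u_r\in[\alpha_r,\beta_r]\}_{j_r=0}^{n_r}$ be their unique normalized B-bases. Denote by $[t_{i_r,j_r}^{n_r}]_{i_r=0,\,j_r=0}^{n_r,\,n_r}$ the regular square matrix that transforms $\mathcal{B}_{n_r}^{\alpha_r,\beta_r}$ to $\mathcal{F}_{n_r}^{\alpha_r,\beta_r}$. Consider the ordinary integral surface $$\mathbf{s}(\mathbf{u})=\left[s^1(\mathbf{u})\ \ s^2(\mathbf{u})\ \ s^3(\mathbf{u})\right]^T\in\mathbb{R}^3,\quad \mathbf{u}=[u_r]_{r=1}^2\in[\alpha_1,\beta_1]\times[\alpha_2,\beta_2],$$ of order $\mathbf{n}=[n_r]_{r=1}^2$, where $$s^{\ell}(\mathbf{u})=\sum_{\zeta=1}^{\sigma_\ell}\prod_{r=1}^{2}\left(\sum_{i_r=0}^{n_r}\lambda_{i_r}^{\ell,\zeta}\varphi_{n_r,i_r}(u_r)\right),\quad\sigma_\ell\ge1,\ \ell=1,2,3.$$ Then the surface can be written as the tensor product EC B-surface of the same order $$\mathbf{s}(\mathbf{u})\equiv\sum_{j_1=0}^{n_1}\sum_{j_2=0}^{n_2}\mathbf{p}_{j_1,j_2}\,b_{n_1,j_1}(u_1)\,b_{n_2,j_2}(u_2),\quad\forall\mathbf{u}\in[\alpha_1,\beta_1]\times[\alpha_2,\beta_2],$$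 where the vectors $\mathbf{p}_{j_1,j_2}=[p_{j_1,j_2}^{\ell}]_{\ell=1}^{3}\in\mathbb{R}^3$ form the control net defined by the coordinates $$p_{j_1,j_2}^{\ell}=\sum_{\zeta=1}^{\sigma_\ell}\prod_{r=1}^{2}p_{j_r}^{\ell,\zeta},\qquad p_{j_r}^{\ell,\zeta}:=\sum_{i_r=0}^{n_r}\lambda_{i_r}^{\ell,\zeta}\,t_{i_r,j_r}^{n_r},\quad j_r=0,\ldots,n_r,\ r=1,2,\ \zeta=1,\ldots,\sigma_\ell,\ \ell=1,2,3.$$
   Context: A system $\{\varphi_{n,i}\}_{i=0}^n\subset C^n([\alpha,\beta])$, $n\ge 1$, $-\infty<\alpha<\beta<\infty$, is an extended Chebyshev (EC) system (ordinary EC basis of its span $\mathbb{S}_n^{\alpha,\beta}$) if for every $0\le r\le n$, all knots $\alpha\le u_0<\cdots<u_r\le\beta$, all positive integers $m_0,\dots,m_r$ with $\sum_k m_k=n+1$, and all reals $\xi_{k,\ell}$, there is a unique $f\in\mathbb{S}_n^{\alpha,\beta}$ with $f^{(\ell)}(u_k)=\xi_{k,\ell}$ for $\ell=0,\ldots,m_k-1$, $k=0,\ldots,r$. It is assumed throughout that the determinants of the coefficient matrices of these Hermite interpolation problems are strictly positive, and that $\varphi_{n,0}\equiv1$. Such a space has a unique non-negative normalized B-basis $\{b_{n,i}\}_{i=0}^n$ (standing fact of the paper, taken from the literature). It is a basis of $\mathbb{S}_n^{\alpha,\beta}$ consisting of non-negative functions that satisfies: $\sum_{i=0}^n b_{n,i}\equiv1$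 on $[\alpha,\beta]$; $b_{n,0}(\alpha)=b_{n,n}(\beta)=1$; for every $i$, $b_{n,i}^{(j)}(\alpha)=0$ for $j=0,\ldots,i-1$ and $b_{n,i}^{(i)}(\alpha)>0$; and $b_{n,i}^{(j)}(\beta)=0$ for $j=0,\ldots,n-1-i$ and $(-1)^{n-i}b_{n,i}^{(n-i)}(\beta)>0$. The matrix transforming the normalized B-basis to the ordinary basis is the one with $\varphi_{n_r,i_r}(u_r)=\sum_{j_r=0}^{n_r}t_{i_r,j_r}^{n_r}b_{n_r,j_r}(u_r)$ for all $u_r\in[\alpha_r,\beta_r]$. The systems, matrices and real coefficients $\lambda_{i_r}^{\ell,\zeta}$ attached to $r=1$ and $r=2$ are independent of each other (the subscript $r$ distinguishes them even if $n_1=n_2$ or $i_1=i_2$); the two spaces may be of different type. *)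

theory Defs
  imports "HOL-Analysis.Analysis" "Jordan_Normal_Form.Determinant"
begin

(* From here on, $ is always the component of a Cartesian vector, and mat/det always refer to
   the matrix type of Jordan_Normal_Form (whose entries are written A $$ (i,j)). *)
no_notation vec_index (infixl "$" 100)
hide_const (open) Finite_Cartesian_Product.mat Determinants.det

(* Derivatives are taken within {a..b}, hence one-sided at the end points; for a < b and x in
   {a..b} they depend only on the values of f on {a..b}. *)
primrec ivl_deriv :: "real \<Rightarrow> real \<Rightarrow> nat \<Rightarrow> (real \<Rightarrow> real) \<Rightarrow> real \<Rightarrow> real" where
  "ivl_deriv a b 0 f = f"
| "ivl_deriv a b (Suc k) f = (\<lambda>x. vector_derivative (ivl_deriv a b k f) (at x within {a..b}))"

definition C_k_on_ivl :: "nat \<Rightarrow> real \<Rightarrow> real \<Rightarrow> (real \<Rightarrow> real) \<Rightarrow> bool" where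
  "C_k_on_ivl n a b f \<longleftrightarrow>
     (\<forall>k<n. \<forall>x\<in>{a..b}. ivl_deriv a b k f differentiable (at x within {a..b})) \<and>
     (\<forall>k\<le>n. continuous_on {a..b} (ivl_deriv a b k f))"

(* Functions on [a,b] are represented by extensional functions, so that equality of elements
   of the span is equality on [a,b]. *)
definition fun_span :: "real \<Rightarrow> real \<Rightarrow> nat \<Rightarrow> (nat \<Rightarrow> real \<Rightarrow> real) \<Rightarrow> (real \<Rightarrow> real) set" where
  "fun_span a b n \<phi> = {(\<lambda>x\<in>{a..b}. \<Sum>i\<le>n. c i * \<phi> i x) | c. True}"

definition fun_independent :: "real \<Rightarrow> real \<Rightarrow> nat \<Rightarrow> (nat \<Rightarrow> real \<Rightarrow> real) \<Rightarrow> bool" where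
  "fun_independent a b n \<phi> \<longleftrightarrow>
     (\<forall>c. (\<forall>x\<in>{a..b}. (\<Sum>i\<le>n. c i * \<phi> i x) = 0) \<longrightarrow> (\<forall>i\<le>n. c i = 0))"

definition fun_basis ::
  "real \<Rightarrow> real \<Rightarrow> nat \<Rightarrow> (nat \<Rightarrow> real \<Rightarrow> real) \<Rightarrow> (real \<Rightarrow> real) set \<Rightarrow> bool" where
  "fun_basis a b n \<phi> S \<longleftrightarrow> fun_independent a b n \<phi> \<and> fun_span a b n \<phi> = S"

definition hermite_knots ::
  "real \<Rightarrow> real \<Rightarrow> nat \<Rightarrow> nat \<Rightarrow> (nat \<Rightarrow> real) \<Rightarrow> (nat \<Rightarrow> nat) \<Rightarrow> bool" where
  "hermite_knots a b n r u m \<longleftrightarrow>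
     a \<le> u 0 \<and> (\<forall>k<r. u k < u (Suc k)) \<and> u r \<le> b \<and> (\<forall>k\<le>r. 1 \<le> m k) \<and> (\<Sum>k\<le>r. m k) = n + 1"

(* The pairs (k, l) with k \<le> r and l < m k in lexicographic order: this is the order of the
   interpolation conditions, i.e. of the rows of the coefficient matrix. *)
definition hermite_conditions :: "nat \<Rightarrow> (nat \<Rightarrow> nat) \<Rightarrow> (nat \<times> nat) list" where
  "hermite_conditions r m = concat (map (\<lambda>k. map (Pair k) [0..<m k]) [0..<Suc r])"

definition hermite_matrix ::
  "real \<Rightarrow> real \<Rightarrow> nat \<Rightarrow> (nat \<Rightarrow> real \<Rightarrow> real) \<Rightarrow> nat \<Rightarrow> (nat \<Rightarrow> real) \<Rightarrow> (nat \<Rightarrow> nat) \<Rightarrow> real mat" where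
  "hermite_matrix a b n \<phi> r u m =
     mat (n + 1) (n + 1)
       (\<lambda>(p, i). case hermite_conditions r m ! p of (k, l) \<Rightarrow> ivl_deriv a b l (\<phi> i) (u k))"

definition EC_system :: "real \<Rightarrow> real \<Rightarrow> nat \<Rightarrow> (nat \<Rightarrow> real \<Rightarrow> real) \<Rightarrow> bool" where
  "EC_system a b n \<phi> \<longleftrightarrow>
     1 \<le> n \<and> a < b \<and> (\<forall>i\<le>n. C_k_on_ivl n a b (\<phi> i)) \<and>
     (\<forall>r\<le>n. \<forall>u m. hermite_knots a b n r u m \<longrightarrow>
        (\<forall>\<xi> :: nat \<Rightarrow> nat \<Rightarrow> real.
           \<exists>!f. f \<in> fun_span a b n \<phi> \<and> (\<forall>k\<le>r. \<forall>l<m k. ivl_deriv a b l f (u k) = \<xi> k l)))"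

definition ordinary_EC_basis :: "real \<Rightarrow> real \<Rightarrow> nat \<Rightarrow> (nat \<Rightarrow> real \<Rightarrow> real) \<Rightarrow> bool" where
  "ordinary_EC_basis a b n \<phi> \<longleftrightarrow>
     EC_system a b n \<phi> \<and>
     (\<forall>r\<le>n. \<forall>u m. hermite_knots a b n r u m \<longrightarrow> 0 < det (hermite_matrix a b n \<phi> r u m)) \<and>
     (\<forall>x\<in>{a..b}. \<phi> 0 x = 1)"

definition normalized_B_basis ::
  "real \<Rightarrow> real \<Rightarrow> nat \<Rightarrow> (real \<Rightarrow> real) set \<Rightarrow> (nat \<Rightarrow> real \<Rightarrow> real) \<Rightarrow> bool" where
  "normalized_B_basis \<alpha> \<beta> n S b \<longleftrightarrow>
     fun_basis \<alpha> \<beta> n b S \<and>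
     (\<forall>i\<le>n. \<forall>x\<in>{\<alpha>..\<beta>}. 0 \<le> b i x) \<and>
     (\<forall>x\<in>{\<alpha>..\<beta>}. (\<Sum>i\<le>n. b i x) = 1) \<and>
     b 0 \<alpha> = 1 \<and> b n \<beta> = 1 \<and>
     (\<forall>i\<le>n. (\<forall>j<i. ivl_deriv \<alpha> \<beta> j (b i) \<alpha> = 0) \<and> 0 < ivl_deriv \<alpha> \<beta> i (b i) \<alpha>) \<and>
     (\<forall>i\<le>n. (\<forall>j<n - i. ivl_deriv \<alpha> \<beta> j (b i) \<beta> = 0) \<and>
            0 < (- 1) ^ (n - i) * ivl_deriv \<alpha> \<beta> (n - i) (b i) \<beta>)"

definition basis_transformation ::
  "real \<Rightarrow> real \<Rightarrow> nat \<Rightarrow> (nat \<Rightarrow> real \<Rightarrow> real) \<Rightarrow> (nat \<Rightarrow> real \<Rightarrow> real) \<Rightarrow> real mat \<Rightarrow> bool" where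
  "basis_transformation \<alpha> \<beta> n b \<phi> T \<longleftrightarrow>
     T \<in> carrier_mat (n + 1) (n + 1) \<and> invertible_mat T \<and>
     (\<forall>i\<le>n. \<forall>x\<in>{\<alpha>..\<beta>}. \<phi> i x = (\<Sum>j\<le>n. T $$ (i, j) * b j x))"

(* The index r of the two directions ranges over the two-element type 2, the coordinate index l
   over the three-element type 3. The coefficient lambda_{i_r}^{l,zeta} is lam r l zeta i. *)
definition integral_surface ::
  "(2 \<Rightarrow> nat) \<Rightarrow> (2 \<Rightarrow> nat \<Rightarrow> real \<Rightarrow> real) \<Rightarrow> (3 \<Rightarrow> nat) \<Rightarrow> (2 \<Rightarrow> 3 \<Rightarrow> nat \<Rightarrow> nat \<Rightarrow> real) \<Rightarrow>
     real^2 \<Rightarrow> real^3" where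
  "integral_surface n \<phi> \<sigma> lam u =
     (\<chi> l. \<Sum>\<zeta>=1..\<sigma> l. \<Prod>r\<in>UNIV. \<Sum>i\<le>n r. lam r l \<zeta> i * \<phi> r i (u $ r))"

definition tensor_B_surface ::
  "(2 \<Rightarrow> nat) \<Rightarrow> (2 \<Rightarrow> nat \<Rightarrow> real \<Rightarrow> real) \<Rightarrow> (nat \<Rightarrow> nat \<Rightarrow> real^3) \<Rightarrow> real^2 \<Rightarrow> real^3" where
  "tensor_B_surface n b p u =
     (\<Sum>j1\<le>n 1. \<Sum>j2\<le>n 2. (b 1 j1 (u $ 1) * b 2 j2 (u $ 2)) *\<^sub>R p j1 j2)"

definition control_coord ::
  "(2 \<Rightarrow> nat) \<Rightarrow> (2 \<Rightarrow> real mat) \<Rightarrow> (2 \<Rightarrow> 3 \<Rightarrow> nat \<Rightarrow> nat \<Rightarrow> real) \<Rightarrow> 2 \<Rightarrow> 3 \<Rightarrow> nat \<Rightarrow> nat \<Rightarrow> real" where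
  "control_coord n T lam r l \<zeta> j = (\<Sum>i\<le>n r. lam r l \<zeta> i * T r $$ (i, j))"

definition control_net ::
  "(2 \<Rightarrow> nat) \<Rightarrow> (2 \<Rightarrow> real mat) \<Rightarrow> (3 \<Rightarrow> nat) \<Rightarrow> (2 \<Rightarrow> 3 \<Rightarrow> nat \<Rightarrow> nat \<Rightarrow> real) \<Rightarrow>
     nat \<Rightarrow> nat \<Rightarrow> real^3" where
  "control_net n T \<sigma> lam j1 j2 =
     (\<chi> l. \<Sum>\<zeta>=1..\<sigma> l. control_coord n T lam 1 l \<zeta> j1 * control_coord n T lam 2 l \<zeta> j2)"

(* A basis transformation always exists and is unique; in particular the regularity demanded in
   its definition is no restriction. *)
lemma basis_coords:
  assumes "fun_span a b n \<phi> = fun_span a b n \<psi>"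
  shows "\<exists>A. A \<in> carrier_mat (n + 1) (n + 1) \<and>
           (\<forall>i\<le>n. \<forall>x\<in>{a..b}. \<phi> i x = (\<Sum>j\<le>n. A $$ (i, j) * \<psi> j x))"
proof -
  have "\<exists>c. \<forall>x\<in>{a..b}. \<phi> i x = (\<Sum>j\<le>n. c j * \<psi> j x)" if i: "i \<le> n" for i
  proof -
    have *: "(\<Sum>j\<le>n. (if j = i then 1 else 0) * \<phi> j x) = \<phi> i x" for x
      using i by (simp add: if_distrib [of "\<lambda>y. y * _"] cong: if_cong)
    have "(\<lambda>x\<in>{a..b}. \<Sum>j\<le>n. (if j = i then 1 else 0) * \<phi> j x) \<in> fun_span a b n \<phi>"
      unfolding fun_span_def
      by (intro CollectI exI [of _ "\<lambda>j. if j = i then 1 else 0"] conjI refl TrueI)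
    then have "(\<lambda>x\<in>{a..b}. \<phi> i x) \<in> fun_span a b n \<psi>"
      using assms by (simp only: *)
    then obtain c where "(\<lambda>x\<in>{a..b}. \<phi> i x) = (\<lambda>x\<in>{a..b}. \<Sum>j\<le>n. c j * \<psi> j x)"
      unfolding fun_span_def by blast
    then show ?thesis
      by (intro exI [of _ c]) (auto simp: restrict_def fun_eq_iff split: if_splits)
  qed
  then obtain C where C: "\<And>i x. i \<le> n \<Longrightarrow> x \<in> {a..b} \<Longrightarrow> \<phi> i x = (\<Sum>j\<le>n. C i j * \<psi> j x)"
    by metis
  show ?thesis
    by (rule exI [of _ "mat (n + 1) (n + 1) (\<lambda>(i, j). C i j)"]) (simp add: C)
qed

lemma basis_coords_unique:
  assumes "fun_independent a b n \<phi>" "i \<le> n" "j \<le> n"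
    and "\<And>x. x \<in> {a..b} \<Longrightarrow> (\<Sum>j\<le>n. c j * \<phi> j x) = (\<Sum>j\<le>n. d j * \<phi> j x)"
  shows "c j = (d j :: real)"
proof -
  have "\<forall>x\<in>{a..b}. (\<Sum>j\<le>n. (c j - d j) * \<phi> j x) = 0"
    using assms(4) by (simp add: left_diff_distrib sum_subtractf)
  then have "\<forall>i\<le>n. c i - d i = 0"
    using assms(1) unfolding fun_independent_def by (auto dest!: spec [of _ "\<lambda>j. c j - d j"])
  with assms(3) show ?thesis
    by simp
qed

lemma basis_coords_inverse:
  fixes A B :: "real mat"
  assumes "fun_independent a b n \<phi>"
    and A: "A \<in> carrier_mat (n + 1) (n + 1)" and B: "B \<in> carrier_mat (n + 1) (n + 1)"
    and \<phi>: "\<And>i x. i \<le> n \<Longrightarrow> x \<in> {a..b} \<Longrightarrow> \<phi> i x = (\<Sum>j\<le>n. A $$ (i, j) * \<psi> j x)"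
    and \<psi>: "\<And>i x. i \<le> n \<Longrightarrow> x \<in> {a..b} \<Longrightarrow> \<psi> i x = (\<Sum>j\<le>n. B $$ (i, j) * \<phi> j x)"
  shows "A * B = 1\<^sub>m (n + 1)"
proof (rule eq_matI)
  fix i k
  assume "i < dim_row (1\<^sub>m (n + 1) :: real mat)" "k < dim_col (1\<^sub>m (n + 1) :: real mat)"
  then have i: "i \<le> n" and k: "k \<le> n"
    by auto
  have "(\<Sum>j\<le>n. A $$ (i, j) * B $$ (j, k)) = (if k = i then 1 else 0)"
  proof (rule basis_coords_unique [OF assms(1) i k])
    fix x
    assume x: "x \<in> {a..b}"
    have "(\<Sum>k\<le>n. (\<Sum>j\<le>n. A $$ (i, j) * B $$ (j, k)) * \<phi> k x) =
            (\<Sum>j\<le>n. A $$ (i, j) * (\<Sum>k\<le>n. B $$ (j, k) * \<phi> k x))"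
      unfolding sum_distrib_left sum_distrib_right
      by (subst sum.swap) (simp add: mult.assoc)
    also have "\<dots> = \<phi> i x"
      using x i by (simp add: \<psi> [symmetric] \<phi> [symmetric])
    also have "\<dots> = (\<Sum>k\<le>n. (if k = i then 1 else 0) * \<phi> k x)"
      using i by (simp add: if_distrib [of "\<lambda>y. y * _"] cong: if_cong)
    finally show "(\<Sum>k\<le>n. (\<Sum>j\<le>n. A $$ (i, j) * B $$ (j, k)) * \<phi> k x) =
      (\<Sum>k\<le>n. (if k = i then 1 else 0) * \<phi> k x)" .
  qed
  moreover have "{0..<Suc n} = {..n}"
    by auto
  ultimately show "(A * B) $$ (i, k) = 1\<^sub>m (n + 1) $$ (i, k)"
    using A B i k by (simp add: scalar_prod_def)
qed (use A B in auto)

lemma basis_transformation_ex1: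
  assumes \<phi>: "fun_basis \<alpha> \<beta> n \<phi> S" and b: "fun_basis \<alpha> \<beta> n b S"
  shows "\<exists>!T. basis_transformation \<alpha> \<beta> n b \<phi> T"
proof -
  obtain T where T: "T \<in> carrier_mat (n + 1) (n + 1)"
      "\<forall>i\<le>n. \<forall>x\<in>{\<alpha>..\<beta>}. \<phi> i x = (\<Sum>j\<le>n. T $$ (i, j) * b j x)"
    using basis_coords [of \<alpha> \<beta> n \<phi> b] assms unfolding fun_basis_def by auto
  obtain R where R: "R \<in> carrier_mat (n + 1) (n + 1)"
      "\<forall>i\<le>n. \<forall>x\<in>{\<alpha>..\<beta>}. b i x = (\<Sum>j\<le>n. R $$ (i, j) * \<phi> j x)"
    using basis_coords [of \<alpha> \<beta> n b \<phi>] assms unfolding fun_basis_def by auto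
  have ind: "fun_independent \<alpha> \<beta> n \<phi>" "fun_independent \<alpha> \<beta> n b"
    using assms by (auto simp: fun_basis_def)
  have "T * R = 1\<^sub>m (n + 1)"
    by (rule basis_coords_inverse [OF ind(1) T(1) R(1) T(2)[rule_format] R(2)[rule_format]])
  moreover have "R * T = 1\<^sub>m (n + 1)"
    by (rule basis_coords_inverse [OF ind(2) R(1) T(1) R(2)[rule_format] T(2)[rule_format]])
  ultimately have TR: "T * R = 1\<^sub>m (n + 1)" "R * T = 1\<^sub>m (n + 1)"
    by blast+
  from TR T(1) R(1) have "invertible_mat T"
    unfolding invertible_mat_def inverts_mat_def by auto
  with T have ex: "basis_transformation \<alpha> \<beta> n b \<phi> T"
    by (simp add: basis_transformation_def)
  show ?thesis
  proof (rule ex1I [of _ T])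
    show "basis_transformation \<alpha> \<beta> n b \<phi> T"
      by (rule ex)
  next
    fix T'
    assume T': "basis_transformation \<alpha> \<beta> n b \<phi> T'"
    show "T' = T"
    proof (rule eq_matI)
      fix i j
      assume "i < dim_row T" "j < dim_col T"
      then have ij: "i \<le> n" "j \<le> n"
        using T(1) by auto
      show "T' $$ (i, j) = T $$ (i, j)"
        by (rule basis_coords_unique [of \<alpha> \<beta> n b i j "\<lambda>j. T' $$ (i, j)" "\<lambda>j. T $$ (i, j)"])
          (use b T(2) T' ij in \<open>auto simp: fun_basis_def basis_transformation_def\<close>)
    qed (use T(1) T' in \<open>auto simp: basis_transformation_def\<close>)
  qed
qed

end

theory Submission
  imports Defs
begin

text \<open>
  The surface is a sum of products of one univariate function per direction, and the claim is a
  change of basis in each factor. Substituting the transformation into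
  \<open>\<Sum>\<^sub>i \<lambda>\<^sub>i \<phi>\<^sub>i\<close> and exchanging the two sums shows that the coordinates of this function
  in the B-basis are the entries of the row vector \<open>\<lambda>\<close> times the transformation matrix
  (\<open>combination_in_B_basis\<close>). By bilinearity, the product of two functions given by coordinates
  has the products of these coordinates as its coefficients in the tensor product basis. Since
  the basis functions do not depend on \<open>\<zeta>\<close>, the sum over \<open>\<zeta>\<close> moves into the coefficients, which
  yields the control net (\<open>sum_of_products_tensor\<close>).
\<close>

lemma combination_in_B_basis:
  assumes "basis_transformation a b n \<psi> \<phi> A" and "x \<in> {a..b}"
  shows "(\<Sum>i\<le>n. c i * \<phi> i x) = (\<Sum>j\<le>n. (\<Sum>i\<le>n. c i * A $$ (i, j)) * \<psi> j x)"
proof -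
  have "(\<Sum>i\<le>n. c i * \<phi> i x) = (\<Sum>i\<le>n. \<Sum>j\<le>n. c i * A $$ (i, j) * \<psi> j x)"
    using assms by (simp add: basis_transformation_def sum_distrib_left mult.assoc)
  also have "\<dots> = (\<Sum>j\<le>n. \<Sum>i\<le>n. c i * A $$ (i, j) * \<psi> j x)"
    by (rule sum.swap)
  finally show ?thesis
    by (simp add: sum_distrib_right)
qed

lemma sum_of_products_tensor:
  fixes p q :: "'z \<Rightarrow> nat \<Rightarrow> 'a::comm_semiring_0"
  shows "(\<Sum>z\<in>Z. (\<Sum>j\<in>J. p z j * f j) * (\<Sum>k\<in>K. q z k * g k)) =
    (\<Sum>j\<in>J. \<Sum>k\<in>K. (f j * g k) * (\<Sum>z\<in>Z. p z j * q z k))"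
proof -
  have "(\<Sum>z\<in>Z. (\<Sum>j\<in>J. p z j * f j) * (\<Sum>k\<in>K. q z k * g k)) =
      (\<Sum>z\<in>Z. \<Sum>j\<in>J. \<Sum>k\<in>K. (f j * g k) * (p z j * q z k))"
    by (simp add: sum_product mult_ac)
  also have "\<dots> = (\<Sum>j\<in>J. \<Sum>z\<in>Z. \<Sum>k\<in>K. (f j * g k) * (p z j * q z k))"
    by (rule sum.swap)
  also have "\<dots> = (\<Sum>j\<in>J. \<Sum>k\<in>K. \<Sum>z\<in>Z. (f j * g k) * (p z j * q z k))"
    by (intro sum.cong refl sum.swap)
  finally show ?thesis
    by (simp add: sum_distrib_left)
qed

theorem theorem2p3:
  fixes n :: "2 \<Rightarrow> nat"
    and \<alpha> \<beta> :: "real^2"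
    and \<phi> b :: "2 \<Rightarrow> nat \<Rightarrow> real \<Rightarrow> real"
    and T :: "2 \<Rightarrow> real mat"
    and \<sigma> :: "3 \<Rightarrow> nat"
    and lam :: "2 \<Rightarrow> 3 \<Rightarrow> nat \<Rightarrow> nat \<Rightarrow> real"
  assumes "\<And>r. ordinary_EC_basis (\<alpha> $ r) (\<beta> $ r) (n r) (\<phi> r)"
    and "\<And>r. normalized_B_basis (\<alpha> $ r) (\<beta> $ r) (n r)
               (fun_span (\<alpha> $ r) (\<beta> $ r) (n r) (\<phi> r)) (b r)"
    and "\<And>r. basis_transformation (\<alpha> $ r) (\<beta> $ r) (n r) (b r) (\<phi> r) (T r)"
    and "\<And>l. \<sigma> l \<ge> 1"
  shows "\<forall>u\<in>cbox \<alpha> \<beta>.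
           integral_surface n \<phi> \<sigma> lam u = tensor_B_surface n b (control_net n T \<sigma> lam) u"
proof
  fix u
  assume u: "u \<in> cbox \<alpha> \<beta>"
  have factor: "(\<Sum>i\<le>n r. lam r l \<zeta> i * \<phi> r i (u $ r)) =
      (\<Sum>j\<le>n r. control_coord n T lam r l \<zeta> j * b r j (u $ r))" for r l \<zeta>
    unfolding control_coord_def
    by (rule combination_in_B_basis [OF assms(3)]) (use u in \<open>simp add: mem_box_cart\<close>)
  show "integral_surface n \<phi> \<sigma> lam u = tensor_B_surface n b (control_net n T \<sigma> lam) u"
  proof (rule Finite_Cartesian_Product.vec_eq_iff [THEN iffD2], rule allI)
    fix l
    have "integral_surface n \<phi> \<sigma> lam u $ l =
        (\<Sum>\<zeta>=1..\<sigma> l. (\<Sum>j\<le>n 1. control_coord n T lam 1 l \<zeta> j * b 1 j (u $ 1)) *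
                    (\<Sum>k\<le>n 2. control_coord n T lam 2 l \<zeta> k * b 2 k (u $ 2)))"
      by (simp add: integral_surface_def factor UNIV_2)
    also have "\<dots> = (\<Sum>j\<le>n 1. \<Sum>k\<le>n 2. (b 1 j (u $ 1) * b 2 k (u $ 2)) *
        (\<Sum>\<zeta>=1..\<sigma> l. control_coord n T lam 1 l \<zeta> j * control_coord n T lam 2 l \<zeta> k))"
      by (rule sum_of_products_tensor)
    also have "\<dots> = tensor_B_surface n b (control_net n T \<sigma> lam) u $ l"
      by (simp add: tensor_B_surface_def control_net_def)
    finally show "integral_surface n \<phi> \<sigma> lam u $ l =
        tensor_B_surface n b (control_net n T \<sigma> lam) u $ l" .
  qed
qed

end
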